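(* Let $x,y$ be real numbers, let $m\ge 1$ be an integer, and let $n=2m-1$ or $n=2m$. Then $$\sum_{k=1}^{n}\binom{n}{k}\big(D_{k}^{(s)}(x,y)-kD_{k-1}^{(s)}(x,y)\big)(1-x)^{n-k}=\begin{cases}(-1)^{m-1}y^{2m-1}, & \text{if } n=2m-1,\\ 0, & \text{if } n=2m.\end{cases}$$
   Context: The sine-derangement polynomials $D_n^{(s)}(x,y)$, $n\ge 0$, are defined by the generating function (power series in $t$) $\displaystyle\frac{e^{-t}}{1-t}e^{xt}\sin(yt)=\sum_{n=0}^{\infty}D_{n}^{(s)}(x,y)\frac{t^{n}}{n!}$. Convention: $0^0=1$. *)

theory Defs
  imports Complex_Main "HOL-Computational_Algebra.Formal_Power_Series"
begin

definition sine_derangement_gf :: "real \<Rightarrow> real \<Rightarrow> real fps" where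
  "sine_derangement_gf x y =
     fps_exp (-1) / (1 - fps_X) * fps_exp x * fps_sin y"

definition sine_derangement :: "nat \<Rightarrow> real \<Rightarrow> real \<Rightarrow> real" where
  "sine_derangement n x y = fact n * fps_nth (sine_derangement_gf x y) n"

lemma sine_derangement_gf_expansion:
  "sine_derangement_gf x y = Abs_fps (\<lambda>n. sine_derangement n x y / fact n)"
  by (rule fps_ext) (simp add: sine_derangement_def)

end

theory Submission
  imports Defs
begin

text \<open>
  On coefficients, multiplying the generating function by \<open>1 - t\<close> turns the \<open>D\<^sub>k\<close> into
  \<open>D\<^sub>k - k D\<^sub>k\<^sub>-\<^sub>1\<close> (\<open>sine_derangement_diff\<close>); on the function itself it removes the
  denominator and leaves \<open>exp ((x - 1) t) sin (y t)\<close>. A binomial convolution with the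
  powers of \<open>1 - x\<close> is multiplication by \<open>exp ((1 - x) t)\<close>
  (\<open>fact_times_nth_mult_fps_exp\<close>), which cancels the remaining exponential. So the sum is
  \<open>n!\<close> times the \<open>n\<close>-th Taylor coefficient of \<open>sin (y t)\<close>, which vanishes for even \<open>n\<close>.
\<close>

lemma fact_times_nth_mult_fps_exp:
  fixes f :: "'a::field_char_0 fps"
  shows "fact n * fps_nth (f * fps_exp c) n =
    (\<Sum>k = 0..n. of_nat (n choose k) * (fact k * fps_nth f k) * c ^ (n - k))"
  unfolding fps_mult_nth sum_distrib_left
  by (rule sum.cong) (simp_all add: binomial_fact)

lemma one_minus_X_times_gf:
  "(1 - fps_X) * sine_derangement_gf x y = fps_exp (x - 1) * fps_sin y"
proof -
  have "(1 - fps_X) * (fps_exp (-1) / (1 - fps_X)) = (fps_exp (-1) :: real fps)"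
    by (simp add: fps_divide_unit mult.left_commute inverse_mult_eq_1')
  then have "(1 - fps_X) * sine_derangement_gf x y = fps_exp (-1) * fps_exp x * fps_sin y"
    unfolding sine_derangement_gf_def by (metis mult.assoc)
  then show ?thesis
    by (simp flip: fps_exp_add_mult)
qed

lemma one_minus_X_times_gf_times_exp:
  "(1 - fps_X) * sine_derangement_gf x y * fps_exp (1 - x) = fps_sin y"
proof -
  have "fps_exp (x - 1) * fps_exp (1 - x) = (1 :: real fps)"
    by (simp flip: fps_exp_add_mult)
  then show ?thesis
    unfolding one_minus_X_times_gf by (metis mult.assoc mult.commute mult_1)
qed

text \<open>
  The factor \<open>k\<close> comes from the factorial in the exponential generating function:
  \<open>k! / (k - 1)! = k\<close>. At \<open>k = 0\<close> it also annihilates the term with the truncated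
  index \<open>k - 1\<close>, so that the identity holds there as well.
\<close>
lemma sine_derangement_diff:
  "sine_derangement k x y - real k * sine_derangement (k - 1) x y =
   fact k * fps_nth ((1 - fps_X) * sine_derangement_gf x y) k"
  by (cases k) (simp_all add: sine_derangement_def algebra_simps)

theorem theorem15:
  fixes x y :: real and m n :: nat
  assumes "m \<ge> 1"
    and "n = 2 * m - 1 \<or> n = 2 * m"
  shows "(\<Sum>k = 1..n. real (n choose k) *
            (sine_derangement k x y - real k * sine_derangement (k - 1) x y) *
            (1 - x) ^ (n - k)) =
         (if n = 2 * m - 1 then (-1) ^ (m - 1) * y ^ (2 * m - 1) else 0)"
proof -
  let ?term = "\<lambda>k. real (n choose k) *
    (sine_derangement k x y - real k * sine_derangement (k - 1) x y) * (1 - x) ^ (n - k)"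
  \<comment> \<open>The binomial convolution starts at \<open>k = 0\<close>, but \<open>D\<^sub>0 = sin 0 = 0\<close>.\<close>
  have "sine_derangement 0 x y = 0"
    by (simp add: sine_derangement_def sine_derangement_gf_def)
  then have "(\<Sum>k = 1..n. ?term k) = (\<Sum>k = 0..n. ?term k)"
    by (simp add: sum.atLeast_Suc_atMost)
  also have "\<dots> = fact n * fps_nth (fps_sin y) n"
    unfolding sine_derangement_diff fact_times_nth_mult_fps_exp [symmetric]
      one_minus_X_times_gf_times_exp ..
  also have "\<dots> = (if n = 2 * m - 1 then (-1) ^ (m - 1) * y ^ (2 * m - 1) else 0)"
  proof -
    obtain j where "m = Suc j"
      using assms(1) by (cases m) auto
    then show ?thesis
      using assms(2) by (auto simp: fps_sin_def simp del: fact_Suc)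
  qed
  finally show ?thesis .
qed

end
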